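(* A real symmetric matrix $A$ has symmetric Kapranov rank two if and only if it has symmetric tropical rank two. (Equivalently, for every $n\ge 3$, the $3\times 3$ minors of an $n\times n$ symmetric matrix of indeterminates form a tropical basis.)
   Context: Let $\tilde K$ be the field of Hahn series $\sum_{\alpha\in A}c_\alpha t^\alpha$ ($A\subset\mathbb R$ well-ordered, $c_\alpha\in\mathbb C$); for nonzero $a\in\tilde K$, $\deg(a)$ is the smallest exponent with nonzero coefficient. A symmetric lift of a real symmetric matrix $A$ is a symmetric matrix $\tilde A$ over $\tilde K$ with all entries nonzero and $\deg(\tilde a_{i,j})=A_{i,j}$; the symmetric Kapranov rank of $A$ is the minimum rank of a symmetric lift. For an $r\times r$ submatrix of $A$ with row index set $I$ and column index set $J$, each bijection $\rho:I\to J$ gives a monomial $\prod_{i\in I}X_{i,\rho(i)}$ in commuting variables subject to $X_{i,j}=X_{j,i}$, with value $\sum_{i\in I}A_{i,\rho(i)}$; the submatrix is symmetrically tropically singular if the minimum value is attained by at least two distinct monomials. The symmetric tropical rank of $A$ is the largest $r$ such that $A$ has an $r\times r$ submatrix that is not symmetrically tropically singular. The $r\times r$ minors form a tropical basis if for every real symmetric $n\times n$ $A$: all $r\times r$ submatrices are symmetrically tropically singular iff $A$ has a symmetric lift of rank $\le r-1$. *)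

theory Defs
  imports Complex_Main "HOL-Combinatorics.Permutations" "HOL-Library.Multiset" "HOL-Library.FuncSet"
begin

text \<open>A Hahn series sum c_a t^a is represented by its coefficient function real => complex;
  it is a Hahn series iff its support is well-ordered.\<close>

definition hahn :: "(real \<Rightarrow> complex) \<Rightarrow> bool" where
  "hahn f \<longleftrightarrow> (\<forall>S. S \<subseteq> {x. f x \<noteq> 0} \<longrightarrow> S \<noteq> {} \<longrightarrow> (\<exists>m\<in>S. \<forall>x\<in>S. m \<le> x))"

definition hdeg :: "(real \<Rightarrow> complex) \<Rightarrow> real" where
  "hdeg f = (LEAST x. f x \<noteq> 0)"

text \<open>Coefficient at exponent g of the product F 0 * ... * F (k-1) of Hahn series
  (Cauchy product; the index set is finite for Hahn series).\<close>

definition hprod_coeff :: "nat \<Rightarrow> (nat \<Rightarrow> real \<Rightarrow> complex) \<Rightarrow> real \<Rightarrow> complex" where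
  "hprod_coeff k F g =
     (\<Sum>a \<in> {a \<in> PiE {..<k} (\<lambda>i. {x. F i x \<noteq> 0}). (\<Sum>i<k. a i) = g}. \<Prod>i<k. F i (a i))"

definition minor_coeff ::
  "(nat \<Rightarrow> nat \<Rightarrow> real \<Rightarrow> complex) \<Rightarrow> nat \<Rightarrow> (nat \<Rightarrow> nat) \<Rightarrow> (nat \<Rightarrow> nat) \<Rightarrow> real \<Rightarrow> complex" where
  "minor_coeff M k r c g =
     (\<Sum>p | p permutes {..<k}. of_int (sign p) * hprod_coeff k (\<lambda>i. M (r i) (c (p i))) g)"

definition hrank :: "nat \<Rightarrow> (nat \<Rightarrow> nat \<Rightarrow> real \<Rightarrow> complex) \<Rightarrow> nat" where
  "hrank n M = (GREATEST k. \<exists>r c. strict_mono_on {..<k} r \<and> strict_mono_on {..<k} c \<and>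
       (\<forall>i<k. r i < n \<and> c i < n) \<and> (\<exists>g. minor_coeff M k r c g \<noteq> 0))"

definition sym_lift :: "nat \<Rightarrow> (nat \<Rightarrow> nat \<Rightarrow> real) \<Rightarrow> (nat \<Rightarrow> nat \<Rightarrow> real \<Rightarrow> complex) \<Rightarrow> bool" where
  "sym_lift n A L \<longleftrightarrow> (\<forall>i<n. \<forall>j<n. hahn (L i j) \<and> L i j \<noteq> (\<lambda>_. 0) \<and>
       hdeg (L i j) = A i j \<and> L i j = L j i)"

definition sym_kapranov_rank :: "nat \<Rightarrow> (nat \<Rightarrow> nat \<Rightarrow> real) \<Rightarrow> nat" where
  "sym_kapranov_rank n A = (LEAST k. \<exists>L. sym_lift n A L \<and> hrank n L = k)"

text \<open>The monomial prod_{i in I} X_{i, rho i} in commuting variables with X_{i,j} = X_{j,i},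
  represented as the multiset of unordered index pairs {i, rho i}.\<close>

definition sym_monomial :: "nat set \<Rightarrow> (nat \<Rightarrow> nat) \<Rightarrow> nat set multiset" where
  "sym_monomial I \<rho> = image_mset (\<lambda>i. {i, \<rho> i}) (mset_set I)"

definition trop_value :: "(nat \<Rightarrow> nat \<Rightarrow> real) \<Rightarrow> nat set \<Rightarrow> (nat \<Rightarrow> nat) \<Rightarrow> real" where
  "trop_value A I \<rho> = (\<Sum>i\<in>I. A i (\<rho> i))"

definition sym_trop_singular :: "(nat \<Rightarrow> nat \<Rightarrow> real) \<Rightarrow> nat set \<Rightarrow> nat set \<Rightarrow> bool" where
  "sym_trop_singular A I J \<longleftrightarrow>
     (\<exists>\<rho>1 \<rho>2. bij_betw \<rho>1 I J \<and> bij_betw \<rho>2 I J \<and>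
        sym_monomial I \<rho>1 \<noteq> sym_monomial I \<rho>2 \<and>
        trop_value A I \<rho>1 = trop_value A I \<rho>2 \<and>
        (\<forall>\<rho>. bij_betw \<rho> I J \<longrightarrow> trop_value A I \<rho>1 \<le> trop_value A I \<rho>))"

definition sym_tropical_rank :: "nat \<Rightarrow> (nat \<Rightarrow> nat \<Rightarrow> real) \<Rightarrow> nat" where
  "sym_tropical_rank n A = (GREATEST k. \<exists>I J. I \<subseteq> {..<n} \<and> J \<subseteq> {..<n} \<and>
       card I = k \<and> card J = k \<and> \<not> sym_trop_singular A I J)"

end

theory Submission
  imports Defs "HOL-Library.Poly_Mapping" "HOL-Library.Infinite_Set"
begin

text \<open>
  If a lift has vanishing \<open>k \<times> k\<close> minors with \<open>k \<le> 3\<close>, the lowest coefficient of each minor must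
  cancel; permutations with the same symmetric monomial have the same sign, so at least two
  monomials attain the minimum. Larger submatrices reduce to these, because deleting from a
  nonsingular submatrix a row and the column matched to it leaves a nonsingular one.

  Conversely, symmetric matrices \<open>s i * s j * (p i + p j)\<close> have rank at most two. Normalise the
  diagonal of the tropical matrix to \<open>0\<close>. Singularity of the \<open>3 \<times> 3\<close> submatrices forces the negative
  entries to be \<open>-\<bar>v i - v j\<bar>\<close> for points \<open>v i\<close> of the line, and forces the entries exceeding
  any level \<open>r \<ge> 0\<close> to form a disjoint union of complete bipartite graphs. Take \<open>p i\<close> of valuation
  \<open>2 * v i\<close> whose coefficient at relative exponent \<open>r\<close> is a label of the component of \<open>i\<close> at level
  \<open>r\<close>, with opposite signs on the two sides of a bipartite component: then \<open>p i + p j\<close> cancels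
  exactly below the prescribed entry.
\<close>

section \<open>Nonzero minors and nonsingular submatrices\<close>

lemma Greatest_nat_less_iff:
  fixes P :: "nat \<Rightarrow> bool"
  assumes "P 0" and bounded: "\<And>k. P k \<Longrightarrow> k \<le> b" and "0 < m"
  shows "(GREATEST k. P k) < m \<longleftrightarrow> (\<forall>k\<ge>m. \<not> P k)"
proof
  assume "(GREATEST k. P k) < m"
  then show "\<forall>k\<ge>m. \<not> P k"
    using Greatest_le_nat[of P _ b] bounded by (force dest: leD)
next
  assume "\<forall>k\<ge>m. \<not> P k"
  moreover have "P (GREATEST k. P k)"
    using GreatestI_nat[of P 0 b] assms by blast
  ultimately show "(GREATEST k. P k) < m" by (meson not_le)
qed

definition has_nonzero_minor :: "nat \<Rightarrow> (nat \<Rightarrow> nat \<Rightarrow> real \<Rightarrow> complex) \<Rightarrow> nat \<Rightarrow> bool" where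
  "has_nonzero_minor n M k \<longleftrightarrow> (\<exists>r c. strict_mono_on {..<k} r \<and> strict_mono_on {..<k} c \<and>
     (\<forall>i<k. r i < n \<and> c i < n) \<and> (\<exists>g. minor_coeff M k r c g \<noteq> 0))"

lemma has_nonzero_minor_0: "has_nonzero_minor n M 0"
proof -
  have "{a. (a :: nat \<Rightarrow> real) = (\<lambda>_. undefined)} = {\<lambda>_. undefined}" by auto
  then have "minor_coeff M 0 id id 0 \<noteq> 0"
    by (simp add: minor_coeff_def hprod_coeff_def)
  then show ?thesis
    unfolding has_nonzero_minor_def
    by (intro exI[of _ id] conjI exI[of _ 0]) (auto simp: strict_mono_on_def)
qed

lemma has_nonzero_minor_le:
  assumes "has_nonzero_minor n M k"
  shows "k \<le> n"
proof -
  obtain r where "strict_mono_on {..<k} r" and "\<forall>i<k. r i < n"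
    using assms unfolding has_nonzero_minor_def by blast
  then have "inj_on r {..<k}" and "r ` {..<k} \<subseteq> {..<n}"
    by (auto intro: strict_mono_on_imp_inj_on)
  then show ?thesis using card_inj_on_le[of r "{..<k}" "{..<n}"] by simp
qed

lemma hrank_less_iff:
  assumes "0 < m"
  shows "hrank n M < m \<longleftrightarrow> (\<forall>k\<ge>m. \<not> has_nonzero_minor n M k)"
proof -
  have "hrank n M = (GREATEST k. has_nonzero_minor n M k)"
    by (simp add: hrank_def has_nonzero_minor_def)
  then show ?thesis
    using Greatest_nat_less_iff[of "has_nonzero_minor n M" n m] has_nonzero_minor_0
      has_nonzero_minor_le assms by simp
qed

definition optimal_matching ::
  "(nat \<Rightarrow> nat \<Rightarrow> real) \<Rightarrow> nat set \<Rightarrow> nat set \<Rightarrow> (nat \<Rightarrow> nat) \<Rightarrow> bool" where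
  "optimal_matching A I J \<rho> \<longleftrightarrow> bij_betw \<rho> I J \<and>
     (\<forall>\<sigma>. bij_betw \<sigma> I J \<longrightarrow> trop_value A I \<rho> \<le> trop_value A I \<sigma>)"

lemma sym_trop_singular_iff_optimal_matching:
  "sym_trop_singular A I J \<longleftrightarrow> (\<exists>\<rho> \<sigma>. optimal_matching A I J \<rho> \<and> optimal_matching A I J \<sigma> \<and>
     sym_monomial I \<rho> \<noteq> sym_monomial I \<sigma>)"
proof
  assume "sym_trop_singular A I J"
  then obtain \<rho> \<sigma> where "bij_betw \<rho> I J" "bij_betw \<sigma> I J"
      "sym_monomial I \<rho> \<noteq> sym_monomial I \<sigma>" "trop_value A I \<rho> = trop_value A I \<sigma>"
      "\<forall>\<pi>. bij_betw \<pi> I J \<longrightarrow> trop_value A I \<rho> \<le> trop_value A I \<pi>"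
    unfolding sym_trop_singular_def by blast
  then have "optimal_matching A I J \<rho>" "optimal_matching A I J \<sigma>"
    by (auto simp: optimal_matching_def)
  with \<open>sym_monomial I \<rho> \<noteq> sym_monomial I \<sigma>\<close>
  show "\<exists>\<rho> \<sigma>. optimal_matching A I J \<rho> \<and> optimal_matching A I J \<sigma> \<and>
      sym_monomial I \<rho> \<noteq> sym_monomial I \<sigma>" by blast
next
  assume "\<exists>\<rho> \<sigma>. optimal_matching A I J \<rho> \<and> optimal_matching A I J \<sigma> \<and>
      sym_monomial I \<rho> \<noteq> sym_monomial I \<sigma>"
  then obtain \<rho> \<sigma> where opt: "optimal_matching A I J \<rho>" "optimal_matching A I J \<sigma>"
      and "sym_monomial I \<rho> \<noteq> sym_monomial I \<sigma>" by blast
  moreover have "trop_value A I \<rho> = trop_value A I \<sigma>"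
    using opt by (simp add: optimal_matching_def order_antisym)
  ultimately show "sym_trop_singular A I J"
    unfolding sym_trop_singular_def optimal_matching_def by blast
qed

lemma ex_optimal_matching:
  assumes "finite I" "finite J" "card I = card J"
  obtains \<rho> where "optimal_matching A I J \<rho>"
proof -
  define V where "V = trop_value A I ` {\<rho>. bij_betw \<rho> I J}"
  have "V \<subseteq> trop_value A I ` (I \<rightarrow>\<^sub>E J)"
  proof
    fix v assume "v \<in> V"
    then obtain \<rho> where \<rho>: "bij_betw \<rho> I J" "v = trop_value A I \<rho>" by (auto simp: V_def)
    have "restrict \<rho> I \<in> I \<rightarrow>\<^sub>E J" using \<rho>(1) by (auto simp: bij_betw_def)
    moreover have "v = trop_value A I (restrict \<rho> I)" using \<rho>(2) by (simp add: trop_value_def)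
    ultimately show "v \<in> trop_value A I ` (I \<rightarrow>\<^sub>E J)" by blast
  qed
  then have "finite V" by (rule finite_subset) (simp add: assms finite_PiE)
  moreover have "V \<noteq> {}" using assms finite_same_card_bij by (auto simp: V_def)
  ultimately obtain \<rho> where "bij_betw \<rho> I J" "trop_value A I \<rho> = Min V"
    using Min_in[of V] unfolding V_def by (metis (mono_tags, lifting) imageE mem_Collect_eq)
  moreover have "Min V \<le> trop_value A I \<sigma>" if "bij_betw \<sigma> I J" for \<sigma>
    using that \<open>finite V\<close> by (intro Min_le) (auto simp: V_def)
  ultimately show ?thesis using that[of \<rho>] by (simp add: optimal_matching_def)
qed

lemma trop_value_fun_upd:
  assumes "finite I" "i \<in> I"
  shows "trop_value A I (\<sigma>(i := j)) = A i j + trop_value A (I - {i}) \<sigma>"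
  using assms by (auto simp: trop_value_def sum.remove intro: sum.cong)

lemma sym_monomial_fun_upd:
  assumes "finite I" "i \<in> I"
  shows "sym_monomial I (\<sigma>(i := j)) = add_mset {i, j} (sym_monomial (I - {i}) \<sigma>)"
  using assms by (auto simp: sym_monomial_def mset_set.remove intro!: image_mset_cong)

lemma bij_betw_fun_upd_insert:
  assumes "bij_betw \<sigma> (I - {i}) (J - {j})" "i \<in> I" "j \<in> J"
  shows "bij_betw (\<sigma>(i := j)) I J"
proof -
  have "bij_betw (\<sigma>(i := j)) (I - {i}) (J - {j})"
    using assms(1) by (rule bij_betw_cong[THEN iffD1, rotated]) auto
  then show ?thesis
    using notIn_Un_bij_betw[of i "I - {i}" "\<sigma>(i := j)" "J - {j}"] assms(2,3)
    by (simp add: insert_absorb)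
qed

lemma optimal_matching_extend:
  assumes "finite I" "i \<in> I" and \<rho>: "optimal_matching A I J \<rho>"
    and \<sigma>: "optimal_matching A (I - {i}) (J - {\<rho> i}) \<sigma>"
  shows "optimal_matching A I J (\<sigma>(i := \<rho> i))"
proof -
  have "\<rho> i \<in> J" and "bij_betw \<rho> (I - {i}) (J - {\<rho> i})"
    using \<rho> \<open>i \<in> I\<close> by (auto simp: optimal_matching_def bij_betw_def inj_on_def)
  then have "bij_betw (\<sigma>(i := \<rho> i)) I J"
    and "trop_value A (I - {i}) \<sigma> \<le> trop_value A (I - {i}) \<rho>"
    using \<sigma> \<open>i \<in> I\<close> by (auto simp: optimal_matching_def intro: bij_betw_fun_upd_insert)
  moreover have "trop_value A I (\<sigma>(i := \<rho> i)) \<le> trop_value A I \<rho>"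
    using calculation(2) trop_value_fun_upd[OF assms(1,2), of A \<sigma> "\<rho> i"]
      trop_value_fun_upd[OF assms(1,2), of A \<rho> "\<rho> i"] by simp
  ultimately show ?thesis using \<rho> by (auto simp: optimal_matching_def intro: order_trans)
qed

lemma nonsingular_delete:
  assumes "card I = Suc k" "card J = Suc k" and nonsingular: "\<not> sym_trop_singular A I J"
  obtains i j where "i \<in> I" "j \<in> J" "\<not> sym_trop_singular A (I - {i}) (J - {j})"
proof -
  have fin: "finite I" "finite J" using assms card.infinite by fastforce+
  obtain \<rho> where \<rho>: "optimal_matching A I J \<rho>" using ex_optimal_matching fin assms by metis
  obtain i where i: "i \<in> I" using assms(1) by fastforce
  have "\<not> sym_trop_singular A (I - {i}) (J - {\<rho> i})"
  proof
    assume "sym_trop_singular A (I - {i}) (J - {\<rho> i})"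
    then obtain \<sigma> \<tau> where "optimal_matching A (I - {i}) (J - {\<rho> i}) \<sigma>"
        "optimal_matching A (I - {i}) (J - {\<rho> i}) \<tau>"
        "sym_monomial (I - {i}) \<sigma> \<noteq> sym_monomial (I - {i}) \<tau>"
      unfolding sym_trop_singular_iff_optimal_matching by blast
    then have "optimal_matching A I J (\<sigma>(i := \<rho> i))" "optimal_matching A I J (\<tau>(i := \<rho> i))"
        "sym_monomial I (\<sigma>(i := \<rho> i)) \<noteq> sym_monomial I (\<tau>(i := \<rho> i))"
      using fin i \<rho> by (auto simp: optimal_matching_extend sym_monomial_fun_upd)
    then show False using nonsingular unfolding sym_trop_singular_iff_optimal_matching by blast
  qed
  moreover have "\<rho> i \<in> J" using \<rho> i by (auto simp: optimal_matching_def bij_betw_def)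
  ultimately show ?thesis using that i by blast
qed

lemma nonsingular_submatrix:
  assumes "card I = k" "card J = k" "\<not> sym_trop_singular A I J" "m \<le> k"
  obtains I' J' where "I' \<subseteq> I" "J' \<subseteq> J" "card I' = m" "card J' = m" "\<not> sym_trop_singular A I' J'"
  using assms
proof (induction k arbitrary: I J thesis)
  case 0
  then show ?case by auto
next
  case (Suc k)
  show ?case
  proof (cases "m = Suc k")
    case True
    then show ?thesis using Suc.prems(1)[of I J] Suc.prems(2-4) by simp
  next
    case False
    obtain i j where "i \<in> I" "j \<in> J" "\<not> sym_trop_singular A (I - {i}) (J - {j})"
      using nonsingular_delete Suc.prems by metis
    moreover have "card (I - {i}) = k" "card (J - {j}) = k" "m \<le> k"
      using calculation Suc.prems False by auto
    ultimately obtain I' J' where "I' \<subseteq> I - {i}" "J' \<subseteq> J - {j}" "card I' = m" "card J' = m"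
        "\<not> sym_trop_singular A I' J'"
      using Suc.IH by blast
    then show ?thesis using Suc.prems(1)[of I' J'] by blast
  qed
qed

definition has_nonsingular_submatrix :: "nat \<Rightarrow> (nat \<Rightarrow> nat \<Rightarrow> real) \<Rightarrow> nat \<Rightarrow> bool" where
  "has_nonsingular_submatrix n A k \<longleftrightarrow> (\<exists>I J. I \<subseteq> {..<n} \<and> J \<subseteq> {..<n} \<and>
     card I = k \<and> card J = k \<and> \<not> sym_trop_singular A I J)"

lemma has_nonsingular_submatrix_0: "has_nonsingular_submatrix n A 0"
  unfolding has_nonsingular_submatrix_def
  by (intro exI[of _ "{}"]) (simp add: sym_trop_singular_def sym_monomial_def)

lemma has_nonsingular_submatrix_le: "has_nonsingular_submatrix n A k \<Longrightarrow> k \<le> n"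
  using card_mono[of "{..<n}"] by (fastforce simp: has_nonsingular_submatrix_def)

lemma has_nonsingular_submatrix_antimono:
  assumes "has_nonsingular_submatrix n A k" "m \<le> k"
  shows "has_nonsingular_submatrix n A m"
proof -
  obtain I J where IJ: "I \<subseteq> {..<n}" "J \<subseteq> {..<n}" "card I = k" "card J = k"
      "\<not> sym_trop_singular A I J"
    using assms(1) unfolding has_nonsingular_submatrix_def by blast
  obtain I' J' where "I' \<subseteq> I" "J' \<subseteq> J" "card I' = m" "card J' = m" "\<not> sym_trop_singular A I' J'"
    using nonsingular_submatrix[OF IJ(3-5) \<open>m \<le> k\<close>] .
  then show ?thesis unfolding has_nonsingular_submatrix_def using IJ(1,2) by blast
qed

lemma sym_tropical_rank_less_iff:
  assumes "0 < m"
  shows "sym_tropical_rank n A < m \<longleftrightarrow> \<not> has_nonsingular_submatrix n A m"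
proof -
  have "sym_tropical_rank n A = (GREATEST k. has_nonsingular_submatrix n A k)"
    by (simp add: sym_tropical_rank_def has_nonsingular_submatrix_def)
  then have "sym_tropical_rank n A < m \<longleftrightarrow> (\<forall>k\<ge>m. \<not> has_nonsingular_submatrix n A k)"
    using Greatest_nat_less_iff[of "has_nonsingular_submatrix n A" n m]
      has_nonsingular_submatrix_0 has_nonsingular_submatrix_le assms by simp
  then show ?thesis using has_nonsingular_submatrix_antimono by blast
qed

lemma sym_trop_singular_shift:
  "sym_trop_singular (\<lambda>i j. A i j + a i + a j) I J \<longleftrightarrow> sym_trop_singular A I J"
proof -
  have "trop_value (\<lambda>i j. A i j + a i + a j) I \<rho> = trop_value A I \<rho> + sum a I + sum a J"
    if "bij_betw \<rho> I J" for \<rho>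
    using sum.reindex_bij_betw[OF that, of a] by (simp add: trop_value_def sum.distrib)
  then have "optimal_matching (\<lambda>i j. A i j + a i + a j) I J = optimal_matching A I J"
    by (intro ext) (simp add: optimal_matching_def cong: conj_cong)
  then show ?thesis by (simp add: sym_trop_singular_iff_optimal_matching)
qed

section \<open>Matrices of small rank\<close>

text \<open>Finitely supported series suffice for the lifts below, and their Cauchy products are the
  products of the group ring \<open>real \<Rightarrow>\<^sub>0 complex\<close>.\<close>

abbreviation lookup :: "('a \<Rightarrow>\<^sub>0 'b::zero) \<Rightarrow> 'a \<Rightarrow> 'b" where
  "lookup \<equiv> Poly_Mapping.lookup"

abbreviation single :: "'a \<Rightarrow> 'b::zero \<Rightarrow> 'a \<Rightarrow>\<^sub>0 'b" where
  "single \<equiv> Poly_Mapping.single"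

lemma poly_mapping_eq_sum_single:
  "p = (\<Sum>a\<in>Poly_Mapping.keys p. single a (lookup p a))"
  by (rule poly_mapping_eqI) (auto simp: lookup_sum lookup_single when_def in_keys_iff sum.delta)

lemma lookup_single_mult:
  fixes p :: "'a::group_add \<Rightarrow>\<^sub>0 'b::semiring_0"
  shows "lookup (single a c * p) s = c * lookup p (- a + s)"
proof -
  have "single a c * p = (\<Sum>b\<in>Poly_Mapping.keys p. single (a + b) (c * lookup p b))"
    by (subst poly_mapping_eq_sum_single[of p]) (simp add: sum_distrib_left mult_single)
  moreover have "a + b = s \<longleftrightarrow> b = - a + s" for b by (auto simp: add.assoc[symmetric])
  ultimately have "lookup (single a c * p) s =
      (\<Sum>b\<in>Poly_Mapping.keys p. if b = - a + s then c * lookup p b else 0)"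
    by (simp only: lookup_sum lookup_single when_def)
  also have "\<dots> = c * lookup p (- a + s)"
    by (subst sum.delta) (auto simp: in_keys_iff)
  finally show ?thesis .
qed

lemma prod_single:
  fixes a :: "'i \<Rightarrow> 'a::comm_monoid_add" and c :: "'i \<Rightarrow> 'b::comm_semiring_1"
  shows "(\<Prod>i\<in>S. single (a i) (c i)) = single (\<Sum>i\<in>S. a i) (\<Prod>i\<in>S. c i)"
  by (induction S rule: infinite_finite_induct) (auto simp: mult_single)

lemma lookup_prod_eq_hprod_coeff:
  fixes F :: "nat \<Rightarrow> real \<Rightarrow>\<^sub>0 complex"
  shows "lookup (\<Prod>i<k. F i) g = hprod_coeff k (\<lambda>i. lookup (F i)) g"
proof -
  let ?K = "PiE {..<k} (\<lambda>i. Poly_Mapping.keys (F i))"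
  have "(\<Prod>i<k. F i) = (\<Prod>i<k. \<Sum>a\<in>Poly_Mapping.keys (F i). single a (lookup (F i) a))"
    by (intro prod.cong refl poly_mapping_eq_sum_single)
  also have "\<dots> = (\<Sum>a\<in>?K. \<Prod>i<k. single (a i) (lookup (F i) (a i)))"
    by (rule prod_sum_PiE) auto
  also have "\<dots> = (\<Sum>a\<in>?K. single (\<Sum>i<k. a i) (\<Prod>i<k. lookup (F i) (a i)))"
    by (simp add: prod_single)
  finally have "lookup (\<Prod>i<k. F i) g =
      (\<Sum>a\<in>?K. if (\<Sum>i<k. a i) = g then \<Prod>i<k. lookup (F i) (a i) else 0)"
    by (simp add: lookup_sum lookup_single when_def)
  also have "\<dots> = (\<Sum>a\<in>{a\<in>?K. (\<Sum>i<k. a i) = g}. \<Prod>i<k. lookup (F i) (a i))"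
    by (rule sum.inter_filter[symmetric]) (simp add: finite_PiE)
  also have "?K = PiE {..<k} (\<lambda>i. {x. lookup (F i) x \<noteq> 0})"
    by (intro PiE_cong) (auto simp: in_keys_iff)
  finally show ?thesis by (simp add: hprod_coeff_def)
qed

lemma minor_coeff_lookup:
  fixes M :: "nat \<Rightarrow> nat \<Rightarrow> real \<Rightarrow>\<^sub>0 complex"
  shows "minor_coeff (\<lambda>i j. lookup (M i j)) k r c g =
    lookup (\<Sum>p | p permutes {..<k}. of_int (sign p) * (\<Prod>i<k. M (r i) (c (p i)))) g"
  by (simp add: minor_coeff_def lookup_prod_eq_hprod_coeff lookup_sum lookup_single_mult
      single_of_int[symmetric] del: single_of_int)

lemma sign_comp_transpose:
  assumes "p permutes S" "finite S" "a \<noteq> b"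
  shows "sign (p \<circ> transpose a b) = - sign p"
  using assms by (simp add: sign_compose permutes_imp_permutation permutation_swap_id sign_swap_id)

lemma sum_sign_mult_eq_0:
  fixes f :: "('i \<Rightarrow> 'i) \<Rightarrow> 'a::comm_ring_1"
  assumes "finite S" and ab: "a \<in> S" "b \<in> S" "a \<noteq> b"
    and invariant: "\<And>p. p permutes S \<Longrightarrow> f (p \<circ> transpose a b) = f p"
  shows "(\<Sum>p | p permutes S. of_int (sign p) * f p) = 0"
proof -
  let ?even = "{p. p permutes S} \<inter> {p. sign p = 1}" and ?odd = "{p. p permutes S} - {p. sign p = 1}"
  have permutes: "p \<circ> transpose a b permutes S" if "p permutes S" for p
    using permutes_compose[OF permutes_swap_id that] ab by blast
  have sign: "sign (p \<circ> transpose a b) = - sign p" if "p permutes S" for p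
    by (rule sign_comp_transpose[OF that \<open>finite S\<close> \<open>a \<noteq> b\<close>])
  have "(\<Sum>p\<in>?odd. of_int (sign p) * f p) = (\<Sum>p\<in>?even. - (of_int (sign p) * f p))"
  proof (rule sum.reindex_bij_witness[of _ "\<lambda>p. p \<circ> transpose a b" "\<lambda>p. p \<circ> transpose a b"])
    show "p \<circ> transpose a b \<in> ?even" if "p \<in> ?odd" for p
      using that permutes sign by (cases p rule: sign_cases) auto
    show "p \<circ> transpose a b \<in> ?odd" if "p \<in> ?even" for p
      using that permutes sign by simp
    show "- (of_int (sign (p \<circ> transpose a b)) * f (p \<circ> transpose a b)) = of_int (sign p) * f p"
      if "p \<in> ?odd" for p
      using that by (simp add: sign invariant)
  qed (auto simp: comp_assoc)
  moreover have "(\<Sum>p | p permutes S. of_int (sign p) * f p) =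
      (\<Sum>p\<in>?even. of_int (sign p) * f p) + (\<Sum>p\<in>?odd. of_int (sign p) * f p)"
    by (rule sum.Int_Diff) (simp add: finite_permutations \<open>finite S\<close>)
  ultimately show ?thesis by (simp only: sum_negf add.right_inverse)
qed

lemma sum_sign_prod_low_rank_eq_0:
  fixes x y :: "'l \<Rightarrow> 'i \<Rightarrow> 'a::comm_ring_1"
  assumes "finite S" "finite L" "card L < card S"
  shows "(\<Sum>p | p permutes S. of_int (sign p) * (\<Prod>i\<in>S. \<Sum>l\<in>L. x l i * y l (p i))) = 0"
proof -
  let ?term = "\<lambda>\<phi> p. \<Prod>i\<in>S. x (\<phi> i) i * y (\<phi> i) (p i)"
  have vanish: "(\<Sum>p | p permutes S. of_int (sign p) * ?term \<phi> p) = 0" if \<phi>: "\<phi> \<in> S \<rightarrow>\<^sub>E L" for \<phi>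
  proof -
    have "card (\<phi> ` S) \<le> card L" using \<phi> \<open>finite L\<close> by (intro card_mono) auto
    then have "\<not> inj_on \<phi> S" using assms(3) by (intro pigeonhole) simp
    then obtain a b where ab: "a \<in> S" "b \<in> S" "a \<noteq> b" "\<phi> a = \<phi> b" by (auto simp: inj_on_def)
    then have \<phi>_transpose: "\<phi> (transpose a b i) = \<phi> i" for i by (simp add: transpose_def)
    show ?thesis
    proof (rule sum_sign_mult_eq_0[OF \<open>finite S\<close> ab(1-3)])
      fix p
      have "(\<Prod>i\<in>S. y (\<phi> i) (p (transpose a b i))) = (\<Prod>i\<in>S. y (\<phi> i) (p i))"
        using prod.permute[OF permutes_swap_id[OF ab(1,2)], of "\<lambda>i. y (\<phi> i) (p i)"]
        by (simp add: comp_def \<phi>_transpose)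
      then show "?term \<phi> (p \<circ> transpose a b) = ?term \<phi> p" by (simp add: prod.distrib)
    qed
  qed
  have "(\<Sum>p | p permutes S. of_int (sign p) * (\<Prod>i\<in>S. \<Sum>l\<in>L. x l i * y l (p i))) =
      (\<Sum>p | p permutes S. \<Sum>\<phi>\<in>S \<rightarrow>\<^sub>E L. of_int (sign p) * ?term \<phi> p)"
    using assms by (simp add: prod_sum_PiE sum_distrib_left)
  also have "\<dots> = (\<Sum>\<phi>\<in>S \<rightarrow>\<^sub>E L. \<Sum>p | p permutes S. of_int (sign p) * ?term \<phi> p)"
    by (rule sum.swap)
  finally show ?thesis using vanish by simp
qed

lemma hrank_lookup_sum_less:
  fixes x y :: "'l \<Rightarrow> nat \<Rightarrow> real \<Rightarrow>\<^sub>0 complex"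
  assumes "finite L" "card L < m"
  shows "hrank n (\<lambda>i j. lookup (\<Sum>l\<in>L. x l i * y l j)) < m"
proof -
  have "minor_coeff (\<lambda>i j. lookup (\<Sum>l\<in>L. x l i * y l j)) k r c g = 0" if "m \<le> k" for k r c g
    using sum_sign_prod_low_rank_eq_0[of "{..<k}" L "\<lambda>l i. x l (r i)" "\<lambda>l j. y l (c j)"] assms that
    by (simp add: minor_coeff_lookup)
  then show ?thesis using assms by (simp add: hrank_less_iff has_nonzero_minor_def)
qed

section \<open>Leading coefficients of minors\<close>

definition leading_exponent :: "('a::linorder \<Rightarrow> 'b::zero) \<Rightarrow> 'a \<Rightarrow> bool" where
  "leading_exponent f d \<longleftrightarrow> f d \<noteq> 0 \<and> (\<forall>x<d. f x = 0)"

lemma leading_exponent_iff_hdeg: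
  assumes "hahn f"
  shows "leading_exponent f d \<longleftrightarrow> f \<noteq> (\<lambda>_. 0) \<and> hdeg f = d"
proof
  assume lead: "leading_exponent f d"
  then have "hdeg f = d"
    unfolding hdeg_def leading_exponent_def
    by (intro Least_equality) (auto simp: not_less[symmetric])
  then show "f \<noteq> (\<lambda>_. 0) \<and> hdeg f = d" using lead by (auto simp: leading_exponent_def)
next
  assume f: "f \<noteq> (\<lambda>_. 0) \<and> hdeg f = d"
  then have "{x. f x \<noteq> 0} \<noteq> {}" by auto
  then obtain m where m: "f m \<noteq> 0" "\<And>x. f x \<noteq> 0 \<Longrightarrow> m \<le> x"
    using assms[unfolded hahn_def, rule_format, of "{x. f x \<noteq> 0}"] by blast
  then have "hdeg f = m" unfolding hdeg_def by (intro Least_equality) auto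
  then show "leading_exponent f d" using f m by (force simp: leading_exponent_def)
qed

lemma sym_lift_iff_leading_exponent:
  "sym_lift n A L \<longleftrightarrow>
    (\<forall>i<n. \<forall>j<n. hahn (L i j) \<and> L i j = L j i \<and> leading_exponent (L i j) (A i j))"
  unfolding sym_lift_def using leading_exponent_iff_hdeg by blast

lemma hprod_coeff_below:
  assumes lead: "\<And>i. i < k \<Longrightarrow> leading_exponent (F i) (d i)" and "g < (\<Sum>i<k. d i)"
  shows "hprod_coeff k F g = 0"
proof -
  have "(\<Sum>i<k. d i) \<le> (\<Sum>i<k. a i)" if "a \<in> PiE {..<k} (\<lambda>i. {x. F i x \<noteq> 0})" for a
    using that lead
    by (intro sum_mono) (auto simp: PiE_iff leading_exponent_def not_less[symmetric])
  then have "{a \<in> PiE {..<k} (\<lambda>i. {x. F i x \<noteq> 0}). (\<Sum>i<k. a i) = g} = {}"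
    using \<open>g < (\<Sum>i<k. d i)\<close> by force
  then show ?thesis unfolding hprod_coeff_def by (simp only: sum.empty)
qed

lemma hprod_coeff_leading:
  assumes lead: "\<And>i. i < k \<Longrightarrow> leading_exponent (F i) (d i)"
  shows "hprod_coeff k F (\<Sum>i<k. d i) = (\<Prod>i<k. F i (d i))"
proof -
  have "{a \<in> PiE {..<k} (\<lambda>i. {x. F i x \<noteq> 0}). (\<Sum>i<k. a i) = (\<Sum>i<k. d i)} = {restrict d {..<k}}"
  proof (intro equalityI subsetI)
    fix a assume "a \<in> {a \<in> PiE {..<k} (\<lambda>i. {x. F i x \<noteq> 0}). (\<Sum>i<k. a i) = (\<Sum>i<k. d i)}"
    then have a: "a \<in> PiE {..<k} (\<lambda>i. {x. F i x \<noteq> 0})" and "(\<Sum>i<k. a i - d i) = 0"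
      by (auto simp: sum_subtractf)
    moreover have "0 \<le> a i - d i" if "i < k" for i
      using a lead[OF that] that by (auto simp: PiE_iff leading_exponent_def not_less[symmetric])
    ultimately have "a i - d i = 0" if "i < k" for i
      using that by (subst (asm) sum_nonneg_eq_0_iff) auto
    then have "a = restrict d {..<k}"
      using a by (intro extensionalityI[of _ "{..<k}"]) (auto simp: PiE_def)
    then show "a \<in> {restrict d {..<k}}" by simp
  qed (use lead in \<open>auto simp: leading_exponent_def\<close>)
  then show ?thesis unfolding hprod_coeff_def by simp
qed

definition minor_value ::
  "(nat \<Rightarrow> nat \<Rightarrow> real) \<Rightarrow> 'i set \<Rightarrow> ('i \<Rightarrow> nat) \<Rightarrow> ('i \<Rightarrow> nat) \<Rightarrow> ('i \<Rightarrow> 'i) \<Rightarrow> real" where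
  "minor_value A K r c p = (\<Sum>i\<in>K. A (r i) (c (p i)))"

definition minor_monomial ::
  "'i set \<Rightarrow> ('i \<Rightarrow> nat) \<Rightarrow> ('i \<Rightarrow> nat) \<Rightarrow> ('i \<Rightarrow> 'i) \<Rightarrow> nat set multiset" where
  "minor_monomial K r c p = image_mset (\<lambda>i. {r i, c (p i)}) (mset_set K)"

lemma trop_value_reindex:
  assumes "inj_on r K" "\<And>i. i \<in> K \<Longrightarrow> \<rho> (r i) = c (p i)"
  shows "trop_value A (r ` K) \<rho> = minor_value A K r c p"
  using assms by (simp add: trop_value_def minor_value_def sum.reindex)

lemma sym_monomial_reindex:
  assumes "inj_on r K" "finite K" "\<And>i. i \<in> K \<Longrightarrow> \<rho> (r i) = c (p i)"
  shows "sym_monomial (r ` K) \<rho> = minor_monomial K r c p"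
  using assms
  unfolding sym_monomial_def minor_monomial_def image_mset_mset_set[OF assms(1), symmetric]
  by (auto simp: multiset.map_comp intro!: image_mset_cong)

lemma permutes_of_bij_betw_image:
  assumes r: "inj_on r K" and c: "inj_on c K" and \<rho>: "bij_betw \<rho> (r ` K) (c ` K)"
  obtains p where "p permutes K" "\<And>i. i \<in> K \<Longrightarrow> \<rho> (r i) = c (p i)"
proof -
  define f where "f = inv_into K c \<circ> (\<rho> \<circ> r)"
  define p where "p = (\<lambda>i. if i \<in> K then f i else i)"
  have "bij_betw f K K"
    unfolding f_def using r c \<rho>
    by (intro bij_betw_trans bij_betw_inv_into) (auto simp: bij_betw_def)
  then have "bij_betw p K K"
    by (rule bij_betw_cong[THEN iffD1, rotated]) (auto simp: p_def)
  then have "p permutes K" by (rule bij_imp_permutes) (auto simp: p_def)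
  moreover have "\<rho> (r i) = c (p i)" if "i \<in> K" for i
    using that bij_betwE[OF \<rho>] by (simp add: p_def f_def f_inv_into_f)
  ultimately show ?thesis using that by blast
qed

lemma bij_betw_image_of_permutes:
  assumes r: "inj_on r K" and c: "inj_on c K" and p: "p permutes K"
  obtains \<rho> where "bij_betw \<rho> (r ` K) (c ` K)" "\<And>i. i \<in> K \<Longrightarrow> \<rho> (r i) = c (p i)"
proof
  show "bij_betw (c \<circ> p \<circ> inv_into K r) (r ` K) (c ` K)"
    using r c permutes_imp_bij[OF p]
    by (intro bij_betw_trans) (auto simp: bij_betw_def inj_on_inv_into)
qed (use r in simp)

lemma nonsingular_optimal_permutation:
  assumes K: "finite K" "inj_on r K" "inj_on c K"
    and nonsingular: "\<not> sym_trop_singular A (r ` K) (c ` K)"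
  obtains p where "p permutes K" "\<And>q. q permutes K \<Longrightarrow> minor_value A K r c p \<le> minor_value A K r c q"
    "\<And>q. q permutes K \<Longrightarrow> minor_value A K r c q = minor_value A K r c p \<Longrightarrow>
      minor_monomial K r c q = minor_monomial K r c p"
proof -
  obtain \<rho> where \<rho>: "optimal_matching A (r ` K) (c ` K) \<rho>"
    using ex_optimal_matching[of "r ` K" "c ` K"] K by (auto simp: card_image)
  obtain p where p: "p permutes K" "\<And>i. i \<in> K \<Longrightarrow> \<rho> (r i) = c (p i)"
    using permutes_of_bij_betw_image K \<rho> by (metis optimal_matching_def)
  have "minor_value A K r c p \<le> minor_value A K r c q \<and>
      (minor_value A K r c q = minor_value A K r c p \<longrightarrow>
        minor_monomial K r c q = minor_monomial K r c p)" if q: "q permutes K" for q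
  proof -
    obtain \<sigma> where \<sigma>: "bij_betw \<sigma> (r ` K) (c ` K)" "\<And>i. i \<in> K \<Longrightarrow> \<sigma> (r i) = c (q i)"
      using bij_betw_image_of_permutes K q by metis
    have "trop_value A (r ` K) \<rho> \<le> trop_value A (r ` K) \<sigma>"
      using \<rho> \<sigma>(1) by (simp add: optimal_matching_def)
    moreover have "sym_monomial (r ` K) \<sigma> = sym_monomial (r ` K) \<rho>"
      if "trop_value A (r ` K) \<sigma> = trop_value A (r ` K) \<rho>"
      using \<rho> \<sigma>(1) that nonsingular
      unfolding sym_trop_singular_iff_optimal_matching optimal_matching_def by metis
    ultimately show ?thesis
      by (simp add: trop_value_reindex[of r K \<rho> c p] trop_value_reindex[of r K \<sigma> c q] K p \<sigma>
          sym_monomial_reindex[of r K \<rho> c p] sym_monomial_reindex[of r K \<sigma> c q])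
  qed
  then show ?thesis using that p(1) by blast
qed

lemma minor_coeff_at_lower_bound:
  assumes lead: "\<And>i j. i < k \<Longrightarrow> j < k \<Longrightarrow> leading_exponent (M (r i) (c j)) (A (r i) (c j))"
    and le: "\<And>p. p permutes {..<k} \<Longrightarrow> v \<le> minor_value A {..<k} r c p"
  shows "minor_coeff M k r c v = (\<Sum>p | p permutes {..<k} \<and> minor_value A {..<k} r c p = v.
    of_int (sign p) * (\<Prod>i<k. M (r i) (c (p i)) (A (r i) (c (p i)))))"
proof -
  let ?P = "{p. p permutes {..<k}}"
  let ?prod = "\<lambda>p. \<Prod>i<k. M (r i) (c (p i)) (A (r i) (c (p i)))"
  have "hprod_coeff k (\<lambda>i. M (r i) (c (p i))) v =
      (if minor_value A {..<k} r c p = v then ?prod p else 0)" if p: "p \<in> ?P" for p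
  proof -
    have "p i < k" if "i < k" for i using p that permutes_in_image[of p "{..<k}" i] by simp
    then have lead_p: "leading_exponent (M (r i) (c (p i))) (A (r i) (c (p i)))" if "i < k" for i
      using lead that by blast
    have "v \<le> minor_value A {..<k} r c p" using p le by simp
    then show ?thesis
      using hprod_coeff_leading[OF lead_p] hprod_coeff_below[OF lead_p]
      by (auto simp: minor_value_def)
  qed
  then have "minor_coeff M k r c v =
      (\<Sum>p\<in>?P. if minor_value A {..<k} r c p = v then of_int (sign p) * ?prod p else 0)"
    unfolding minor_coeff_def by (intro sum.cong) auto
  then show ?thesis by (simp add: sum.inter_filter[symmetric] finite_permutations)
qed

lemma prod_eq_if_minor_monomial_eq:
  fixes f :: "nat \<Rightarrow> nat \<Rightarrow> 'b::comm_monoid_mult"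
  assumes symmetric: "\<And>i j. i \<in> V \<Longrightarrow> j \<in> V \<Longrightarrow> f i j = f j i"
    and V: "r ` K \<subseteq> V" "c ` K \<subseteq> V" and "p permutes K" "q permutes K"
    and "minor_monomial K r c p = minor_monomial K r c q"
  shows "(\<Prod>i\<in>K. f (r i) (c (p i))) = (\<Prod>i\<in>K. f (r i) (c (q i)))"
proof -
  define h where "h = (\<lambda>S. f (Min S) (Max S))"
  have h: "h {i, j} = f i j" if "i \<in> V" "j \<in> V" for i j
    using symmetric[OF that] by (cases "i \<le> j") (auto simp: h_def min_def max_def)
  have "(\<Prod>i\<in>K. f (r i) (c (p i))) = prod_mset (image_mset h (minor_monomial K r c p))"
    if "p permutes K" for p
  proof -
    have "(\<Prod>i\<in>K. f (r i) (c (p i))) = (\<Prod>i\<in>K. h {r i, c (p i)})"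
      using h V permutes_in_image[OF that] by (intro prod.cong) (auto simp: image_subset_iff)
    then show ?thesis
      by (simp add: prod_unfold_prod_mset minor_monomial_def multiset.map_comp comp_def)
  qed
  then show ?thesis using assms by simp
qed

section \<open>Lifts have nonzero minors at nonsingular submatrices\<close>

lemma permutes_card_le_2:
  assumes "p permutes S" "finite S" "card S \<le> 2"
  shows "p = id \<or> (\<exists>a\<in>S. \<exists>b\<in>S. a \<noteq> b \<and> p = transpose a b)"
proof -
  consider "card S = 0" | "card S = 1" | "card S = 2" using assms(3) by linarith
  then show ?thesis
  proof cases
    assume "card S = 0"
    then show ?thesis using assms by simp
  next
    assume "card S = 1"
    then show ?thesis using assms(1) by (auto simp: card_1_singleton_iff)
  next
    assume "card S = 2"
    then obtain a b where "S = {a, b}" "a \<noteq> b" by (auto simp: card_2_iff)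
    then show ?thesis using assms(1) by (auto simp: permutes_doubleton_iff)
  qed
qed

lemma odd_permutes_card_le_3:
  assumes p: "p permutes S" and "finite S" "card S \<le> 3" and odd: "sign p = -1"
  obtains a b where "a \<in> S" "b \<in> S" "a \<noteq> b" "p = transpose a b"
proof -
  have "p \<noteq> id" using odd by auto
  then obtain a where a: "p a \<noteq> a" by fastforce
  let ?t = "transpose a (p a)"
  have aS: "a \<in> S" "p a \<in> S" using a p by (metis permutes_not_in permutes_in_image)+
  then have t: "?t permutes S" by (intro permutes_swap_id)
  have "?t \<circ> p permutes S - {a}"
    using permutes_superset[OF permutes_compose[OF p t], of "S - {a}"] by auto
  moreover have "sign (?t \<circ> p) = 1"
    using sign_compose[of ?t p] p \<open>finite S\<close> odd a
    by (simp add: permutes_imp_permutation permutation_swap_id sign_swap_id)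
  moreover have "card (S - {a}) \<le> 2" using assms aS by simp
  ultimately have "?t \<circ> p = id"
    using permutes_card_le_2[of "?t \<circ> p" "S - {a}"] \<open>finite S\<close>
    by (auto simp: sign_swap_id simp del: comp_apply)
  then have "?t \<circ> (?t \<circ> p) = ?t" by simp
  then have "p = ?t" by (simp add: comp_assoc[symmetric])
  then show ?thesis using that aS a by metis
qed

lemma minor_monomial_comp_transpose_neq:
  assumes "finite K" "inj_on r K" "inj_on c K" and q: "q permutes K" and ab: "a \<in> K" "b \<in> K" "a \<noteq> b"
  shows "minor_monomial K r c (q \<circ> transpose a b) \<noteq> minor_monomial K r c q"
proof
  assume eq: "minor_monomial K r c (q \<circ> transpose a b) = minor_monomial K r c q"
  have "K = insert a (insert b (K - {a, b}))" using ab by auto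
  then have "mset_set K = mset_set (insert a (insert b (K - {a, b})))" by simp
  also have "\<dots> = add_mset a (add_mset b (mset_set (K - {a, b})))" using ab \<open>finite K\<close> by simp
  finally have split: "mset_set K = \<dots>" .
  have "image_mset (\<lambda>i. {r i, c (q (transpose a b i))}) (mset_set (K - {a, b})) =
      image_mset (\<lambda>i. {r i, c (q i)}) (mset_set (K - {a, b}))"
    using \<open>finite K\<close> by (intro image_mset_cong) (auto simp: transpose_def)
  then have "{#{r a, c (q b)}, {r b, c (q a)}#} = {#{r a, c (q a)}, {r b, c (q b)}#}"
    using eq by (simp add: minor_monomial_def split) (simp add: add_mset_commute)
  then have "{r a, c (q b)} = {r a, c (q a)} \<or> {r a, c (q b)} = {r b, c (q b)}"
    by (auto simp: add_eq_conv_ex)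
  then have "c (q b) = c (q a) \<or> r a = r b" by (auto simp: doubleton_eq_iff)
  moreover have "r a \<noteq> r b" using assms by (auto simp: inj_on_def)
  moreover have "q b \<noteq> q a" using permutes_inj[OF q] ab(3) by (auto dest: injD)
  then have "c (q b) \<noteq> c (q a)"
    using inj_onD[OF \<open>inj_on c K\<close>, of "q b" "q a"] ab permutes_in_image[OF q] by blast
  ultimately show False by blast
qed

lemma sign_eq_if_minor_monomial_eq:
  assumes K: "finite K" "card K \<le> 3" "inj_on r K" "inj_on c K"
    and p: "p permutes K" and q: "q permutes K"
    and eq: "minor_monomial K r c p = minor_monomial K r c q"
  shows "sign p = sign q"
proof (rule ccontr)
  assume "sign p \<noteq> sign q"
  have "permutation p" "permutation q" using p q K(1) by (auto intro: permutes_imp_permutation)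
  then have "sign (inv q \<circ> p) = sign q * sign p"
    by (simp add: sign_compose sign_inverse permutation_inverse)
  also have "\<dots> = -1"
    using \<open>sign p \<noteq> sign q\<close> by (cases p rule: sign_cases; cases q rule: sign_cases) auto
  finally obtain a b where ab: "a \<in> K" "b \<in> K" "a \<noteq> b" "inv q \<circ> p = transpose a b"
    using odd_permutes_card_le_3[OF permutes_compose[OF p permutes_inv[OF q]] K(1,2)] by blast
  have "q \<circ> transpose a b = p"
    using permutes_inv_o(1)[OF q] by (simp add: ab(4)[symmetric] comp_assoc[symmetric])
  then show False
    using minor_monomial_comp_transpose_neq[OF K(1,3,4) q ab(1-3)] eq by simp
qed

lemma nonsingular_imp_minor_coeff_nonzero:
  assumes lift: "sym_lift n A L" and "k \<le> 3"
    and rc: "inj_on r {..<k}" "inj_on c {..<k}" "\<forall>i<k. r i < n \<and> c i < n"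
    and nonsingular: "\<not> sym_trop_singular A (r ` {..<k}) (c ` {..<k})"
  shows "\<exists>g. minor_coeff L k r c g \<noteq> 0"
proof -
  let ?val = "minor_value A {..<k} r c"
  let ?coeff = "\<lambda>p. \<Prod>i<k. L (r i) (c (p i)) (A (r i) (c (p i)))"
  have lead: "leading_exponent (L i j) (A i j)" if "i < n" "j < n" for i j
    using lift that by (simp add: sym_lift_iff_leading_exponent)
  obtain p where p: "p permutes {..<k}" and min: "\<And>q. q permutes {..<k} \<Longrightarrow> ?val p \<le> ?val q"
    and unique: "\<And>q. q permutes {..<k} \<Longrightarrow> ?val q = ?val p \<Longrightarrow>
      minor_monomial {..<k} r c q = minor_monomial {..<k} r c p"
    using nonsingular_optimal_permutation[OF finite_lessThan rc(1,2) nonsingular] by blast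
  let ?M = "{q. q permutes {..<k} \<and> ?val q = ?val p}"
  have "minor_coeff L k r c (?val p) = (\<Sum>q\<in>?M. of_int (sign q) * ?coeff q)"
    using lead rc(3) min by (intro minor_coeff_at_lower_bound) auto
  also have "\<dots> = (\<Sum>q\<in>?M. of_int (sign p) * ?coeff p)"
  proof (rule sum.cong)
    fix q assume "q \<in> ?M"
    then have q: "q permutes {..<k}"
      and eq: "minor_monomial {..<k} r c q = minor_monomial {..<k} r c p"
      using unique by auto
    have "sign q = sign p"
      using sign_eq_if_minor_monomial_eq[OF _ _ rc(1,2) q p eq] \<open>k \<le> 3\<close> by simp
    moreover have "?coeff q = ?coeff p"
    proof (rule prod_eq_if_minor_monomial_eq[where V = "{..<n}" and c = c
          and f = "\<lambda>i j. L i j (A i j)"])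
      show "L i j (A i j) = L j i (A j i)" if "i \<in> {..<n}" "j \<in> {..<n}" for i j
        using lift that unfolding sym_lift_def by (metis lessThan_iff)
    qed (use rc(3) q p eq in auto)
    ultimately show "of_int (sign q) * ?coeff q = of_int (sign p) * ?coeff p" by simp
  qed simp
  also have "\<dots> = of_nat (card ?M) * (of_int (sign p) * ?coeff p)" by simp
  also have "\<dots> \<noteq> 0"
  proof -
    have "finite ?M" by (rule finite_subset[OF _ finite_permutations[of "{..<k}"]]) auto
    then have "card ?M \<noteq> 0" using p by auto
    moreover have "?coeff p \<noteq> 0"
      using lead rc(3) permutes_in_image[OF p] by (auto simp: leading_exponent_def)
    ultimately show ?thesis by simp
  qed
  finally show ?thesis by blast
qed

lemma has_nonzero_minor_if_has_nonsingular_submatrix: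
  assumes "sym_lift n A L" "has_nonsingular_submatrix n A k" "k \<le> 3"
  shows "has_nonzero_minor n L k"
proof -
  obtain I J where IJ: "I \<subseteq> {..<n}" "J \<subseteq> {..<n}" "card I = k" "card J = k"
      and nonsingular: "\<not> sym_trop_singular A I J"
    using assms(2) unfolding has_nonsingular_submatrix_def by blast
  then have "finite I" "finite J" using finite_subset by blast+
  then obtain r c where r: "bij_betw r {..<k} I" "strict_mono_on {..<k} r"
      and c: "bij_betw c {..<k} J" "strict_mono_on {..<k} c"
    using ex_bij_betw_strict_mono_card IJ(3,4) by metis
  then have images: "r ` {..<k} = I" "c ` {..<k} = J" and inj: "inj_on r {..<k}" "inj_on c {..<k}"
    by (auto simp: bij_betw_def)
  then have bounds: "\<forall>i<k. r i < n \<and> c i < n" using IJ(1,2) by auto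
  then have "\<exists>g. minor_coeff L k r c g \<noteq> 0"
    using nonsingular_imp_minor_coeff_nonzero assms(1,3) inj nonsingular images by blast
  then show ?thesis using r(2) c(2) bounds unfolding has_nonzero_minor_def by blast
qed

lemma sym_tropical_rank_less_if_hrank_less:
  assumes "sym_lift n A L" "hrank n L < m" "0 < m" "m \<le> 3"
  shows "sym_tropical_rank n A < m"
  using assms has_nonzero_minor_if_has_nonsingular_submatrix
  by (auto simp: hrank_less_iff sym_tropical_rank_less_iff)

section \<open>Metrics on a line\<close>

definition collinear_triple :: "('a \<Rightarrow> 'a \<Rightarrow> real) \<Rightarrow> 'a \<Rightarrow> 'a \<Rightarrow> 'a \<Rightarrow> bool" where
  "collinear_triple d x y z \<longleftrightarrow>
     d x z = d x y + d y z \<or> d x y = d x z + d z y \<or> d y z = d y x + d x z"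

definition pseudo_linear_quadruple :: "('a \<Rightarrow> 'a \<Rightarrow> real) \<Rightarrow> 'a \<Rightarrow> 'a \<Rightarrow> 'a \<Rightarrow> 'a \<Rightarrow> bool" where
  "pseudo_linear_quadruple d p x q y \<longleftrightarrow> 0 < d p x \<and> 0 < d x q \<and> d q y = d p x \<and> d y p = d x q \<and>
     d p q = d p x + d x q \<and> d x y = d p x + d x q"

text \<open>Menger's theorem: pseudo-linear quadruples are the only obstruction to a global embedding.
  The distance from an endpoint of a diameter serves as the coordinate.\<close>

lemma line_embedding:
  fixes d :: "'a \<Rightarrow> 'a \<Rightarrow> real"
  assumes "finite X"
    and symmetric: "\<And>x y. x \<in> X \<Longrightarrow> y \<in> X \<Longrightarrow> d x y = d y x"
    and nonneg: "\<And>x y. x \<in> X \<Longrightarrow> y \<in> X \<Longrightarrow> 0 \<le> d x y"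
    and collinear: "\<And>x y z. x \<in> X \<Longrightarrow> y \<in> X \<Longrightarrow> z \<in> X \<Longrightarrow> collinear_triple d x y z"
    and not_pseudo_linear: "\<And>p x q y. p \<in> X \<Longrightarrow> x \<in> X \<Longrightarrow> q \<in> X \<Longrightarrow> y \<in> X \<Longrightarrow>
      \<not> pseudo_linear_quadruple d p x q y"
  obtains v :: "'a \<Rightarrow> real" where "\<And>x y. x \<in> X \<Longrightarrow> y \<in> X \<Longrightarrow> d x y = \<bar>v x - v y\<bar>"
proof (cases "X = {}")
  case False
  let ?D = "(\<lambda>(x, y). d x y) ` (X \<times> X)"
  have "finite ?D" "?D \<noteq> {}" using \<open>finite X\<close> False by auto
  then have "Max ?D \<in> ?D" and "\<And>x y. x \<in> X \<Longrightarrow> y \<in> X \<Longrightarrow> d x y \<le> Max ?D"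
    by (auto intro!: Max_in Max_ge)
  then obtain p q where pq: "p \<in> X" "q \<in> X"
      and diameter: "\<And>x y. x \<in> X \<Longrightarrow> y \<in> X \<Longrightarrow> d x y \<le> d p q" by auto
  have "d x y = \<bar>d p x - d p y\<bar>" if xy: "x \<in> X" "y \<in> X" for x y
  proof (rule ccontr)
    assume not_embedded: "d x y \<noteq> \<bar>d p x - d p y\<bar>"
    note metric = symmetric[OF xy] symmetric[OF xy(1) pq(1)] symmetric[OF xy(1) pq(2)]
      symmetric[OF xy(2) pq(1)] symmetric[OF xy(2) pq(2)]
      nonneg[OF pq(1) xy(1)] nonneg[OF pq(1) xy(2)] nonneg[OF pq(2) xy(1)] nonneg[OF pq(2) xy(2)]
      nonneg[OF xy]
    have between: "d p q = d p x + d x q" "d p q = d p y + d y q"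
      using collinear[OF pq(1) xy(1) pq(2)] collinear[OF pq(1) xy(2) pq(2)]
        diameter[OF pq(1) xy(1)] diameter[OF pq(1) xy(2)] diameter[OF xy(1) pq(2)]
        diameter[OF xy(2) pq(2)] metric
      unfolding collinear_triple_def by linarith+
    have p_between: "d x y = d p x + d p y"
      using collinear[OF xy(1) pq(1) xy(2)] not_embedded metric
      unfolding collinear_triple_def by linarith
    have q_between: "d x y = d x q + d y q"
      using collinear[OF xy(1) pq(2) xy(2)] not_embedded between metric
      unfolding collinear_triple_def by linarith
    have "0 < d p x" "0 < d p y"
      using p_between not_embedded metric by linarith+
    then have "pseudo_linear_quadruple d p x q y"
      using p_between q_between between metric unfolding pseudo_linear_quadruple_def by linarith
    then show False using not_pseudo_linear pq xy by blast
  qed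
  then show ?thesis using that by blast
qed (use that in simp)

section \<open>Labellings of disjoint unions of complete bipartite graphs\<close>

lemma rtrancl_path_closed:
  assumes "E O E O E \<subseteq> E"
  shows "E\<^sup>* = Id \<union> E \<union> E O E"
proof
  show "E\<^sup>* \<subseteq> Id \<union> E \<union> E O E"
  proof
    fix e assume "e \<in> E\<^sup>*"
    then have "(fst e, snd e) \<in> E\<^sup>*" by simp
    then have "(fst e, snd e) \<in> Id \<union> E \<union> E O E"
      by (induction rule: rtrancl_induct) (use assms in blast)+
    then show "e \<in> Id \<union> E \<union> E O E" by simp
  qed
qed (auto intro: rtrancl_trans)

text \<open>An irreflexive path-closed graph has no triangles, hence is a disjoint union of complete
  bipartite graphs. Its label is the least vertex of the component, signed by the side.\<close>

lemma ex_opposite_labelling: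
  fixes E :: "(nat \<times> nat) set"
  assumes "sym E" "irrefl E" and path_closed: "E O E O E \<subseteq> E"
  obtains f :: "nat \<Rightarrow> int" where "\<And>i j. f i + f j = 0 \<longleftrightarrow> (i, j) \<in> E"
proof -
  have E_sym: "(j, i) \<in> E" if "(i, j) \<in> E" for i j using \<open>sym E\<close> that by (rule symD)
  have path: "(i, l) \<in> E" if "(i, j) \<in> E" "(j, k) \<in> E" "(k, l) \<in> E" for i j k l
    using path_closed that by blast
  have no_triangle: "\<not> ((i, k) \<in> E \<and> (j, k) \<in> E)" if "(i, j) \<in> E" for i j k
    using path[of i j k i] E_sym that \<open>irrefl E\<close> by (auto simp: irrefl_def)
  define m where "m = (\<lambda>i. LEAST j. (i, j) \<in> E\<^sup>*)"
  define f where "f = (\<lambda>i. if (i, m i) \<in> E then - int (Suc (m i)) else int (Suc (m i)))"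
  have m: "i = m i \<or> (i, m i) \<in> E \<or> (\<exists>k. (i, k) \<in> E \<and> (k, m i) \<in> E)" for i
  proof -
    have "(i, m i) \<in> E\<^sup>*" unfolding m_def by (rule LeastI[of _ i]) simp
    then show ?thesis unfolding rtrancl_path_closed[OF path_closed] by auto
  qed
  have "f i + f j = 0" if ij: "(i, j) \<in> E" for i j
  proof -
    have "(i, l) \<in> E\<^sup>* \<longleftrightarrow> (j, l) \<in> E\<^sup>*" for l
      using ij E_sym[OF ij] by (meson converse_rtrancl_into_rtrancl)
    then have "m i = m j" by (simp add: m_def)
    moreover have "(i, m i) \<in> E \<or> (j, m i) \<in> E" using m[of i] ij E_sym path by metis
    ultimately show ?thesis using no_triangle[OF ij] by (auto simp: f_def)
  qed
  moreover have adjacent_if_opposite: "(i, j) \<in> E"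
    if "m i = m j" "(i, m i) \<in> E" "(j, m j) \<notin> E" for i j
    using m[of j] that E_sym path by metis
  have "(i, j) \<in> E" if "f i + f j = 0" for i j
    using that adjacent_if_opposite[of i j] adjacent_if_opposite[of j i] E_sym
    by (auto simp: f_def split: if_splits)
  ultimately show ?thesis using that by blast
qed

section \<open>Tropical rank two\<close>

lemma sym_trop_singular_competitor:
  assumes "sym_trop_singular A I J" "bij_betw \<pi> I J"
  obtains \<rho> where "bij_betw \<rho> I J" "sym_monomial I \<rho> \<noteq> sym_monomial I \<pi>"
    "trop_value A I \<rho> \<le> trop_value A I \<pi>"
proof -
  obtain \<sigma> \<tau> where "optimal_matching A I J \<sigma>" "optimal_matching A I J \<tau>"
      "sym_monomial I \<sigma> \<noteq> sym_monomial I \<tau>"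
    using assms(1) unfolding sym_trop_singular_iff_optimal_matching by blast
  then show ?thesis
    using that[of \<sigma>] that[of \<tau>] assms(2)
    by (cases "sym_monomial I \<sigma> = sym_monomial I \<pi>") (auto simp: optimal_matching_def)
qed

lemma sym_trop_singular_doubleton:
  assumes "sym_trop_singular A {i, j} {i, j}"
  shows "A i i + A j j = A i j + A j i"
proof (cases "i = j")
  case False
  have bij_cases: "\<rho> i = i \<and> \<rho> j = j \<or> \<rho> i = j \<and> \<rho> j = i" if "bij_betw \<rho> {i, j} {i, j}" for \<rho>
    using that False by (auto simp: bij_betw_def)
  obtain \<sigma> \<tau> where "bij_betw \<sigma> {i, j} {i, j}" "bij_betw \<tau> {i, j} {i, j}"
      "sym_monomial {i, j} \<sigma> \<noteq> sym_monomial {i, j} \<tau>"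
      "trop_value A {i, j} \<sigma> = trop_value A {i, j} \<tau>"
    using assms unfolding sym_trop_singular_def by blast
  then show ?thesis
    using bij_cases[of \<sigma>] bij_cases[of \<tau>] False by (auto simp: sym_monomial_def trop_value_def)
qed simp

lemma sym_trop_singular_3x3_competitor:
  assumes ijk: "i \<noteq> j" "i \<noteq> k" "j \<noteq> k" and xyz: "x \<noteq> y" "x \<noteq> z" "y \<noteq> z"
    and singular: "sym_trop_singular A {i, j, k} {x, y, z}"
  shows "\<exists>(a, b, c) \<in> {(x, z, y), (y, x, z), (y, z, x), (z, x, y), (z, y, x)}.
    A i a + A j b + A k c \<le> A i x + A j y + A k z \<and>
    {#{i, a}, {j, b}, {k, c}#} \<noteq> {#{i, x}, {j, y}, {k, z}#}"
proof -
  have val: "trop_value A {i, j, k} \<rho> = A i (\<rho> i) + A j (\<rho> j) + A k (\<rho> k)" for \<rho>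
    using ijk by (simp add: trop_value_def)
  have mon: "sym_monomial {i, j, k} \<rho> = {#{i, \<rho> i}, {j, \<rho> j}, {k, \<rho> k}#}" for \<rho>
    using ijk by (simp add: sym_monomial_def)
  define \<pi> where "\<pi> = (\<lambda>_. z)(i := x, j := y)"
  have \<pi>: "\<pi> i = x" "\<pi> j = y" "\<pi> k = z" using ijk by (auto simp: \<pi>_def)
  then have "bij_betw \<pi> {i, j, k} {x, y, z}"
    using ijk xyz by (auto simp: bij_betw_def inj_on_def)
  then obtain \<rho> where \<rho>: "bij_betw \<rho> {i, j, k} {x, y, z}"
      "sym_monomial {i, j, k} \<rho> \<noteq> sym_monomial {i, j, k} \<pi>"
      "trop_value A {i, j, k} \<rho> \<le> trop_value A {i, j, k} \<pi>"
    using sym_trop_singular_competitor singular by blast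
  have "\<rho> i \<in> {x, y, z}" "\<rho> j \<in> {x, y, z}" "\<rho> k \<in> {x, y, z}" "\<rho> i \<noteq> \<rho> j" "\<rho> i \<noteq> \<rho> k" "\<rho> j \<noteq> \<rho> k"
    using \<rho>(1) ijk by (auto simp: bij_betw_def inj_on_def)
  moreover have "(\<rho> i, \<rho> j, \<rho> k) \<noteq> (x, y, z)" using \<rho>(2) \<pi> by (auto simp: mon)
  ultimately have "(\<rho> i, \<rho> j, \<rho> k) \<in> {(x, z, y), (y, x, z), (y, z, x), (z, x, y), (z, y, x)}"
    by (elim insertE emptyE) simp_all
  then show ?thesis
    using \<rho>(2,3) \<pi> by (intro bexI[of _ "(\<rho> i, \<rho> j, \<rho> k)"]) (simp_all add: val mon)
qed

text \<open>The entries stand for \<open>A i j - A i i / 2 - A j j / 2\<close>: this change shifts all values of a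
  given submatrix by the same amount, so it preserves singularity.\<close>

locale normalized_tropical_rank_two =
  fixes n :: nat and B :: "nat \<Rightarrow> nat \<Rightarrow> real"
  assumes symmetric: "i < n \<Longrightarrow> j < n \<Longrightarrow> B i j = B j i"
    and diagonal: "i < n \<Longrightarrow> B i i = 0"
    and singular: "\<not> has_nonsingular_submatrix n B 3"
begin

lemma competitor_3x3:
  assumes "{i, j, k} \<subseteq> {..<n}" "i \<noteq> j" "i \<noteq> k" "j \<noteq> k" "{x, y, z} \<subseteq> {..<n}" "x \<noteq> y" "x \<noteq> z" "y \<noteq> z"
  shows "\<exists>(a, b, c) \<in> {(x, z, y), (y, x, z), (y, z, x), (z, x, y), (z, y, x)}.
    B i a + B j b + B k c \<le> B i x + B j y + B k z \<and>
    {#{i, a}, {j, b}, {k, c}#} \<noteq> {#{i, x}, {j, y}, {k, z}#}"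
proof -
  have "card {i, j, k} = 3" "card {x, y, z} = 3" using assms by auto
  then have "sym_trop_singular B {i, j, k} {x, y, z}"
    using singular assms(1,5) unfolding has_nonsingular_submatrix_def by blast
  then show ?thesis using assms by (intro sym_trop_singular_3x3_competitor)
qed

lemma triple_cases:
  assumes ijk: "i < n" "j < n" "k < n" "i \<noteq> j" "i \<noteq> k" "j \<noteq> k"
  defines "a \<equiv> B i j" and "b \<equiv> B i k" and "c \<equiv> B j k"
  shows "(a \<ge> 0 \<and> b \<ge> 0 \<and> c \<ge> 0 \<and> (a = 0 \<or> b = 0 \<or> c = 0)) \<or>
    (a < 0 \<and> b = a \<and> c \<ge> 0) \<or> (a < 0 \<and> c = a \<and> b \<ge> 0) \<or> (b < 0 \<and> c = b \<and> a \<ge> 0) \<or>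
    (a < 0 \<and> b < 0 \<and> c < 0 \<and> (a = b + c \<or> b = a + c \<or> c = a + b))"
proof -
  have entries: "B i j = a" "B i k = b" "B j k = c" "B j i = a" "B k i = b" "B k j = c"
      "B i i = 0" "B j j = 0" "B k k = 0"
    using ijk symmetric diagonal by (auto simp: a_def b_def c_def)
  have cycles: "{#{i, k}, {j, i}, {k, j}#} = {#{i, j}, {j, k}, {k, i}#}"
    by (simp add: insert_commute add_mset_commute)
  have identity: "a \<le> 0 \<or> b \<le> 0 \<or> c \<le> 0"
    using competitor_3x3[of i j k i j k] ijk entries by auto
  have swap_ij: "0 \<le> a \<or> b \<le> a \<or> c \<le> a \<or> b + c \<le> a"
    using competitor_3x3[of i j k j i k] ijk entries by auto
  have swap_ik: "0 \<le> b \<or> a \<le> b \<or> c \<le> b \<or> a + c \<le> b"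
    using competitor_3x3[of i j k k j i] ijk entries by auto
  have swap_jk: "0 \<le> c \<or> a \<le> c \<or> b \<le> c \<or> a + b \<le> c"
    using competitor_3x3[of i j k i k j] ijk entries by auto
  have cycle: "0 \<le> a + b + c \<or> a \<le> b + c \<or> b \<le> a + c \<or> c \<le> a + b"
    using competitor_3x3[of i j k j k i] ijk entries cycles by auto
  show ?thesis using identity swap_ij swap_ik swap_jk cycle by argo
qed

text \<open>If \<open>s i * s j * (p i + p j)\<close> has valuation \<open>0\<close> on the diagonal, then a negative valuation of
  an entry is minus half the distance between the valuations of \<open>p i\<close> and \<open>p j\<close>.\<close>

definition line_dist :: "nat \<Rightarrow> nat \<Rightarrow> real" where
  "line_dist i j = max 0 (- B i j)"

lemma line_dist_collinear:
  assumes "i < n" "j < n" "k < n"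
  shows "collinear_triple line_dist i j k"
proof (cases "i \<noteq> j \<and> i \<noteq> k \<and> j \<noteq> k")
  case True
  then show ?thesis
    using triple_cases[of i j k] assms symmetric[of j i] symmetric[of k j]
    unfolding collinear_triple_def line_dist_def by (auto simp: max_def)
next
  case False
  then show ?thesis
    using assms symmetric diagonal by (auto simp: collinear_triple_def line_dist_def)
qed

lemma not_pseudo_linear_quadruple_line_dist:
  assumes "p < n" "x < n" "q < n" "y < n"
  shows "\<not> pseudo_linear_quadruple line_dist p x q y"
proof
  assume pl: "pseudo_linear_quadruple line_dist p x q y"
  define \<alpha> \<beta> where "\<alpha> = line_dist p x" and "\<beta> = line_dist x q"
  have pos: "0 < \<alpha>" "0 < \<beta>"
    and dist: "line_dist p x = \<alpha>" "line_dist q y = \<alpha>" "line_dist x q = \<beta>" "line_dist y p = \<beta>"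
      "line_dist p q = \<alpha> + \<beta>" "line_dist x y = \<alpha> + \<beta>"
    using pl by (auto simp: pseudo_linear_quadruple_def \<alpha>_def \<beta>_def)
  have "B i j = - line_dist i j" if "0 < line_dist i j" for i j
    using that by (simp add: line_dist_def max_def split: if_splits)
  then have B: "B p x = - \<alpha>" "B q y = - \<alpha>" "B x q = - \<beta>" "B y p = - \<beta>"
      "B p q = - (\<alpha> + \<beta>)" "B x y = - (\<alpha> + \<beta>)"
    using pos dist by (metis add_pos_pos)+
  have ne: "p \<noteq> x" "p \<noteq> q" "p \<noteq> y" "x \<noteq> q" "x \<noteq> y" "q \<noteq> y"
    using B pos diagonal[OF assms(1)] diagonal[OF assms(2)] diagonal[OF assms(3)] by auto
  have "B x p = - \<alpha>" "B p y = - \<beta>" "B q x = - \<beta>" "B q p = - (\<alpha> + \<beta>)" "B p p = 0" "B x x = 0"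
    using B symmetric diagonal assms by metis+
  then show False
    using competitor_3x3[of p x q x y p] assms ne pos B by auto
qed

lemma line_dist_embedding:
  obtains v :: "nat \<Rightarrow> real" where "\<And>i j. i < n \<Longrightarrow> j < n \<Longrightarrow> line_dist i j = \<bar>v i - v j\<bar>"
proof (rule line_embedding[of "{..<n}" line_dist])
  show "line_dist i j = line_dist j i" if "i \<in> {..<n}" "j \<in> {..<n}" for i j
    using that symmetric by (simp add: line_dist_def)
  show "0 \<le> line_dist i j" for i j by (simp add: line_dist_def)
qed (use line_dist_collinear not_pseudo_linear_quadruple_line_dist that in auto)

definition superlevel_graph :: "real \<Rightarrow> (nat \<times> nat) set" where
  "superlevel_graph r = {(i, j). i < n \<and> j < n \<and> r < B i j}"

lemma nonadjacent_if_common_neighbour: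
  assumes "i < n" "j < n" "k < n" "0 < B i j" "0 < B j k"
  shows "B i k = 0"
proof (cases "i = k")
  case False
  moreover have "i \<noteq> j" "j \<noteq> k" using assms(4,5) diagonal[OF assms(2)] by auto
  ultimately show ?thesis using triple_cases[of i j k] assms by auto
qed (use assms diagonal in auto)

lemma superlevel_graph_path_closed:
  assumes "0 \<le> r"
  shows "superlevel_graph r O superlevel_graph r O superlevel_graph r \<subseteq> superlevel_graph r"
proof -
  have "r < B i l" if ijkl: "i < n" "j < n" "k < n" "l < n"
    and edges: "r < B i j" "r < B j k" "r < B k l" for i j k l
  proof (rule ccontr)
    assume no_edge: "\<not> r < B i l"
    have ik: "B i k = 0" and jl: "B j l = 0"
      using nonadjacent_if_common_neighbour[of i j k] nonadjacent_if_common_neighbour[of j k l]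
        that \<open>0 \<le> r\<close> by auto
    have B_sym: "B k j = B j k" "B k i = B i k" using symmetric ijkl by auto
    have ne: "i \<noteq> j" "j \<noteq> k" "k \<noteq> l" "i \<noteq> k" "j \<noteq> l" "i \<noteq> l"
      using edges no_edge ik jl \<open>0 \<le> r\<close> diagonal[OF ijkl(2)] diagonal[OF ijkl(3)] B_sym by auto
    have "0 \<le> B i l" using triple_cases[of i j l] ijkl ne jl edges(1) \<open>0 \<le> r\<close> by auto
    then show False
      using competitor_3x3[of i j k l j k] ijkl ne edges no_edge ik jl B_sym \<open>0 \<le> r\<close> diagonal
      by auto
  qed
  then show ?thesis by (auto simp: superlevel_graph_def)
qed

lemma superlevel_graph_labelling:
  assumes "0 \<le> r"
  obtains f :: "nat \<Rightarrow> int"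
    where "\<And>i j. i < n \<Longrightarrow> j < n \<Longrightarrow> f i + f j = 0 \<longleftrightarrow> r < B i j"
proof (rule ex_opposite_labelling[of "superlevel_graph r"])
  show "sym (superlevel_graph r)"
    using symmetric by (auto simp: sym_def superlevel_graph_def)
  show "irrefl (superlevel_graph r)"
    using diagonal assms by (auto simp: irrefl_def superlevel_graph_def)
qed (use that superlevel_graph_path_closed[OF assms] in \<open>auto simp: superlevel_graph_def\<close>)

end

section \<open>Construction of lifts\<close>

lemma hahn_lookup: "hahn (lookup p)"
  unfolding hahn_def
proof (intro allI impI)
  fix S assume S: "S \<subseteq> {x. lookup p x \<noteq> 0}" "S \<noteq> {}"
  then have "finite S" by (metis finite_lookup finite_subset)
  then show "\<exists>m\<in>S. \<forall>x\<in>S. m \<le> x" using S(2) Min_in Min_le by metis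
qed

lemma sym_lift_lookupI:
  assumes "\<And>i j. i < n \<Longrightarrow> j < n \<Longrightarrow> M i j = M j i"
    and "\<And>i j. i < n \<Longrightarrow> j < n \<Longrightarrow> leading_exponent (lookup (M i j)) (A i j)"
  shows "sym_lift n A (\<lambda>i j. lookup (M i j))"
  using assms by (simp add: sym_lift_iff_leading_exponent hahn_lookup)

lemma leading_exponent_single:
  fixes a :: "'a::linorder" and c :: "'b::zero"
  assumes "c \<noteq> 0"
  shows "leading_exponent (lookup (single a c)) a"
  using assms by (simp add: leading_exponent_def lookup_single when_def)

lemma leading_exponent_shift:
  fixes p :: "'a::linordered_ab_group_add \<Rightarrow>\<^sub>0 'b::semiring_1"
  assumes "leading_exponent (lookup p) d"
  shows "leading_exponent (lookup (single a 1 * p)) (d + a)"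
  using assms by (simp add: leading_exponent_def lookup_single_mult algebra_simps)

lemma leading_exponent_add:
  fixes p q :: "'a::linorder \<Rightarrow>\<^sub>0 'b::comm_monoid_add"
  assumes "leading_exponent (lookup p) d" "leading_exponent (lookup q) e" "d < e"
  shows "leading_exponent (lookup (p + q)) d"
  using assms by (simp add: leading_exponent_def lookup_add)

lemma leading_exponent_add_opposite_shifts:
  fixes p q :: "'a::linordered_ab_group_add \<Rightarrow>\<^sub>0 'b::semiring_1"
  assumes p: "leading_exponent (lookup p) 0" and q: "leading_exponent (lookup q) 0" and "b \<noteq> 0"
  shows "leading_exponent (lookup (single b 1 * p + single (- b) 1 * q)) (min b (- b))"
proof -
  have shift: "leading_exponent (lookup (single b 1 * p)) b"
      "leading_exponent (lookup (single (- b) 1 * q)) (- b)"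
    using leading_exponent_shift[OF p, of b] leading_exponent_shift[OF q, of "- b"] by simp_all
  consider "b < - b" | "- b < b" using \<open>b \<noteq> 0\<close> by force
  then show ?thesis
  proof cases
    assume "b < - b"
    then show ?thesis using leading_exponent_add[OF shift] by (simp add: min_absorb1)
  next
    assume "- b < b"
    then show ?thesis
      using leading_exponent_add[OF shift(2,1)] by (simp add: min_absorb2 add.commute)
  qed
qed

lemma ex_lift_hrank_less_2:
  assumes symmetric: "\<forall>i<n. \<forall>j<n. A i j = A j i" and rank: "sym_tropical_rank n A < 2"
  shows "\<exists>L. sym_lift n A L \<and> hrank n L < 2"
proof -
  define a where "a = (\<lambda>i. A i i / 2)"
  define x :: "nat \<Rightarrow> real \<Rightarrow>\<^sub>0 complex" where "x = (\<lambda>i. single (a i) 1)"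
  have "A i j = a i + a j" if ij: "i < n" "j < n" for i j
  proof (cases "i = j")
    case False
    then have "sym_trop_singular A {i, j} {i, j}"
      using rank ij by (auto simp: sym_tropical_rank_less_iff has_nonsingular_submatrix_def)
    then have "A i i + A j j = A i j + A j i" by (rule sym_trop_singular_doubleton)
    moreover have "A j i = A i j" using symmetric ij by simp
    ultimately show ?thesis unfolding a_def by linarith
  qed (simp add: a_def)
  then have "sym_lift n A (\<lambda>i j. lookup (x i * x j))"
    by (intro sym_lift_lookupI)
      (simp_all add: x_def mult_single add.commute leading_exponent_single)
  moreover have "hrank n (\<lambda>i j. lookup (x i * x j)) < 2"
    using hrank_lookup_sum_less[of "UNIV :: unit set" 2 n "\<lambda>_. x" "\<lambda>_. x"] by (simp add: UNIV_unit)
  ultimately show ?thesis by blast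
qed

context normalized_tropical_rank_two
begin

lemma ex_level_series:
  obtains p :: "nat \<Rightarrow> real \<Rightarrow>\<^sub>0 complex"
    where "\<And>i. i < n \<Longrightarrow> leading_exponent (lookup (p i)) 0"
      "\<And>i j. i < n \<Longrightarrow> j < n \<Longrightarrow> 0 \<le> B i j \<Longrightarrow> leading_exponent (lookup (p i + p j)) (B i j)"
proof -
  have "\<exists>f :: nat \<Rightarrow> int. 0 \<le> r \<longrightarrow> (\<forall>i<n. \<forall>j<n. f i + f j = 0 \<longleftrightarrow> r < B i j)" for r
    by (metis superlevel_graph_labelling)
  then obtain label :: "real \<Rightarrow> nat \<Rightarrow> int"
    where label: "\<And>r i j. 0 \<le> r \<Longrightarrow> i < n \<Longrightarrow> j < n \<Longrightarrow> label r i + label r j = 0 \<longleftrightarrow> r < B i j"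
    by metis
  define R where "R = insert 0 {r \<in> (\<lambda>(i, j). B i j) ` ({..<n} \<times> {..<n}). 0 \<le> r}"
  have R: "finite R" "\<And>r. r \<in> R \<Longrightarrow> 0 \<le> r" by (auto simp: R_def)
  define p :: "nat \<Rightarrow> real \<Rightarrow>\<^sub>0 complex" where "p = (\<lambda>i. \<Sum>r\<in>R. single r (of_int (label r i)))"
  have lookup_p: "lookup (p i) s = (if s \<in> R then of_int (label s i) else 0)" for i s
    using R(1) by (simp add: p_def lookup_sum lookup_single when_def)
  then have lookup_p_add:
    "lookup (p i + p j) s = (if s \<in> R then of_int (label s i + label s j) else 0)" for i j s
    by (simp add: lookup_add)
  show ?thesis
  proof
    show "leading_exponent (lookup (p i)) 0" if "i < n" for i
      using label[of 0 i i] diagonal[OF that] that R(2)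
      by (force simp: leading_exponent_def lookup_p R_def)
    show "leading_exponent (lookup (p i + p j)) (B i j)"
      if ij: "i < n" "j < n" and "0 \<le> B i j" for i j
    proof -
      have "B i j \<in> R" using that by (auto simp: R_def)
      then have "lookup (p i + p j) (B i j) \<noteq> 0"
        using label[OF \<open>0 \<le> B i j\<close> ij] by (simp add: lookup_p_add del: of_int_add)
      moreover have "lookup (p i + p j) s = 0" if "s < B i j" for s
        using that label[OF _ ij] R(2) by (auto simp: lookup_p_add simp del: of_int_add)
      ultimately show ?thesis by (simp add: leading_exponent_def)
    qed
  qed
qed

text \<open>With \<open>s i = t^(a i - v i)\<close> the entries are
  \<open>s i * s j * (t^(2 * v i) * p i + t^(2 * v j) * p j)\<close>: the smaller of \<open>v i\<close> and \<open>v j\<close> determines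
  the leading exponent if they differ, and the cancellation in \<open>p i + p j\<close> otherwise.\<close>

lemma ex_rank_two_lift:
  fixes a :: "nat \<Rightarrow> real"
  obtains x y :: "nat \<Rightarrow> real \<Rightarrow>\<^sub>0 complex"
    where "sym_lift n (\<lambda>i j. B i j + a i + a j) (\<lambda>i j. lookup (x i * y j + y i * x j))"
proof -
  obtain v where v: "\<And>i j. i < n \<Longrightarrow> j < n \<Longrightarrow> line_dist i j = \<bar>v i - v j\<bar>"
    using line_dist_embedding by blast
  obtain p :: "nat \<Rightarrow> real \<Rightarrow>\<^sub>0 complex"
    where p: "\<And>i. i < n \<Longrightarrow> leading_exponent (lookup (p i)) 0"
      and p_add: "\<And>i j. i < n \<Longrightarrow> j < n \<Longrightarrow> 0 \<le> B i j \<Longrightarrow> leading_exponent (lookup (p i + p j)) (B i j)"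
    using ex_level_series by blast
  define q where "q = (\<lambda>i j. single (v j - v i) 1 * p j + single (v i - v j) 1 * p i)"
  have q: "leading_exponent (lookup (q i j)) (B i j)" if ij: "i < n" "j < n" for i j
  proof (cases "v i = v j")
    case True
    then have "0 \<le> B i j" using v[OF ij] by (simp add: line_dist_def)
    then show ?thesis using p_add[OF ij] True by (simp add: q_def add.commute)
  next
    case False
    then have "B i j = min (v j - v i) (- (v j - v i))"
      using v[OF ij] by (auto simp: line_dist_def)
    then show ?thesis
      using leading_exponent_add_opposite_shifts[OF p[OF ij(2)] p[OF ij(1)], of "v j - v i"] False
      by (simp add: q_def)
  qed
  define x :: "nat \<Rightarrow> real \<Rightarrow>\<^sub>0 complex" where "x = (\<lambda>i. single (a i - v i) 1)"
  define y where "y = (\<lambda>i. single (a i + v i) 1 * p i)"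
  have "a i - v i + (a j + v j) = a i + a j + (v j - v i)" for i j by simp
  then have "x i * y j = single (a i + a j) 1 * (single (v j - v i) 1 * p j)" for i j
    by (simp only: x_def y_def mult.assoc[symmetric] mult_single mult_1)
  then have entry: "x i * y j + y i * x j = single (a i + a j) 1 * q i j" for i j
    by (simp add: q_def distrib_left mult.commute[of "y i"] add.commute[of "a i"])
  have "sym_lift n (\<lambda>i j. B i j + a i + a j) (\<lambda>i j. lookup (x i * y j + y i * x j))"
  proof (rule sym_lift_lookupI)
    show "leading_exponent (lookup (x i * y j + y i * x j)) (B i j + a i + a j)"
      if "i < n" "j < n" for i j
      using leading_exponent_shift[OF q[OF that], of "a i + a j"] by (simp add: entry add.assoc)
  qed (simp add: ac_simps)
  then show ?thesis using that by blast
qed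

end

lemma ex_lift_hrank_less_3:
  assumes symmetric: "\<forall>i<n. \<forall>j<n. A i j = A j i" and rank: "sym_tropical_rank n A < 3"
  shows "\<exists>L. sym_lift n A L \<and> hrank n L < 3"
proof -
  define a where "a = (\<lambda>i. A i i / 2)"
  define B where "B = (\<lambda>i j. A i j - a i - a j)"
  have A: "A = (\<lambda>i j. B i j + a i + a j)" by (simp add: B_def)
  have "sym_trop_singular A = sym_trop_singular B"
    by (subst A) (intro ext sym_trop_singular_shift)
  then interpret normalized_tropical_rank_two n B
    using rank symmetric
    by unfold_locales
      (auto simp: sym_tropical_rank_less_iff has_nonsingular_submatrix_def B_def a_def)
  obtain x y :: "nat \<Rightarrow> real \<Rightarrow>\<^sub>0 complex"
    where "sym_lift n A (\<lambda>i j. lookup (x i * y j + y i * x j))"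
    using ex_rank_two_lift[of a, folded A] .
  moreover have "hrank n (\<lambda>i j. lookup (x i * y j + y i * x j)) < 3"
    using hrank_lookup_sum_less[of "UNIV :: bool set" 3 n "\<lambda>b. if b then x else y"
        "\<lambda>b. if b then y else x"] by (simp add: UNIV_bool add.commute)
  ultimately show ?thesis by blast
qed

lemma sym_kapranov_rank_less_iff:
  assumes "\<forall>i<n. \<forall>j<n. A i j = A j i"
  shows "sym_kapranov_rank n A < m \<longleftrightarrow> (\<exists>L. sym_lift n A L \<and> hrank n L < m)"
proof -
  have "sym_lift n A (\<lambda>i j. lookup (single (A i j) 1))"
    using assms by (intro sym_lift_lookupI leading_exponent_single) auto
  then have "\<exists>k L. sym_lift n A L \<and> hrank n L = k" by blast
  then have "\<exists>L. sym_lift n A L \<and> hrank n L = sym_kapranov_rank n A"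
    unfolding sym_kapranov_rank_def by (rule LeastI_ex)
  moreover have "sym_kapranov_rank n A \<le> hrank n L" if "sym_lift n A L" for L
    unfolding sym_kapranov_rank_def using that by (intro Least_le) blast
  ultimately show ?thesis by (metis le_less_trans)
qed

theorem theorem6:
  fixes n :: nat and A :: "nat \<Rightarrow> nat \<Rightarrow> real"
  assumes "\<forall>i<n. \<forall>j<n. A i j = A j i"
  shows "sym_kapranov_rank n A = 2 \<longleftrightarrow> sym_tropical_rank n A = 2"
proof -
  have "sym_kapranov_rank n A < 2 \<longleftrightarrow> sym_tropical_rank n A < 2"
    using sym_kapranov_rank_less_iff[OF assms] sym_tropical_rank_less_if_hrank_less
      ex_lift_hrank_less_2[OF assms] by fastforce
  moreover have "sym_kapranov_rank n A < 3 \<longleftrightarrow> sym_tropical_rank n A < 3"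
    using sym_kapranov_rank_less_iff[OF assms] sym_tropical_rank_less_if_hrank_less
      ex_lift_hrank_less_3[OF assms] by fastforce
  ultimately show ?thesis by linarith
qed

end
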